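(* Under the constraint that the two model distributions have disjoint supports, the optimal slack factor for robust testing with respect to the squared Hellinger distance $H^2$ equals $\frac{\sqrt2}{\sqrt2-1}$. That is: (i) for every $\gamma>\frac{\sqrt2}{\sqrt2-1}$, every domain $\mathcal X$, and every class $\mathcal P=\{p_0,p_1\}$ of distributions on $\mathcal X$ with $\mathrm{supp}(p_0)\cap\mathrm{supp}(p_1)=\emptyset$, the class $\mathcal P$ is $\gamma$-robustly testable with respect to $H^2$; (ii) for every $\gamma$ with $1<\gamma<\frac{\sqrt2}{\sqrt2-1}$, there exist a domain $\mathcal X$ and a class $\mathcal P=\{p_0,p_1\}$ of distributions on $\mathcal X$ with $\mathrm{supp}(p_0)\cap\mathrm{supp}(p_1)=\emptyset$ that is not $\gamma$-robustly testable with respect to $H^2$.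
   Context: Distributions. The domain $\mathcal X$ is either a discrete (countable) set, in which case a distribution on $\mathcal X$ means a probability mass function, or $\mathcal X=\mathbb R^d$, in which case a distribution means a probability density with respect to Lebesgue measure. Let $\Delta(\mathcal X)$ be the set of all such distributions. Integrals are read as sums in the discrete case. The support of a distribution is $\mathrm{supp}(p)=\{x\in\mathcal X: p(x)>0\}$. Squared Hellinger distance: $H^2(p,q)=\frac12\int_{\mathcal X}\left(\sqrt{p(x)}-\sqrt{q(x)}\right)^2dx=1-\int_{\mathcal X}\sqrt{p(x)q(x)}\,dx$. Robust testability. Let $\mathcal P=\{p_0,p_1\}$ with $p_0\neq p_1$ in $\Delta(\mathcal X)$ and let $\gamma>1$. For a target distribution $p\in\Delta(\mathcal X)$ consider the hypotheses $$H_0:\ \gamma H^2(p,p_0)\le H^2(p,p_1),\qquad H_1:\ H^2(p,p_0)\ge\gamma H^2(p,p_1).$$ A (possibly randomized) test is a family of measurable maps $T_m:\mathcal X^m\to[0,1]$, $m\ge1$, where $T_m(x_1,\dots,x_m)$ is the probability of outputting $p_1$ (otherwise $p_0$ is output) upon observing $x_1,\dots,x_m$. The class $\mathcal P$ is $\gamma$-robustly testable (with respect to $H^2$) if there is a test such that for every $\delta>0$ there is a finite $m(\delta)$ such that for every target distribution $p\in\Delta(\mathcal X)$ satisfying $H_0$ or $H_1$, and every $m\ge m(\delta)$, the test given $m$ i.i.d. samples from $p$ outputs the element $q$ of $\mathcal P$ minimizing $H^2(q,p)$ (that is, $p_0$ under $H_0$ and $p_1$ under $H_1$) with probability at least $1-\delta$.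 The bound $m(\delta)$ may depend on $\mathcal P$ and $\gamma$ but not on $p$. *)

theory Defs
  imports "HOL-Probability.Probability"
begin

(* The domain is given by its base measure M: counting measure on a countable set, or Lebesgue
   measure on R^d. Since d is quantified inside the theorem, R^d is the set of extensional
   functions on {..<d}; its sigma-algebra is the Borel one. *)

definition lebesgue_Rd :: "nat \<Rightarrow> (nat \<Rightarrow> real) measure" where
  "lebesgue_Rd d = PiM {..<d} (\<lambda>_. lborel)"

(* Only the values of p on space M matter. *)
definition distributions :: "'a measure \<Rightarrow> ('a \<Rightarrow> real) set" where
  "distributions M = {p. p \<in> borel_measurable M \<and> (\<forall>x\<in>space M. 0 \<le> p x) \<and>
                         (\<integral>\<^sup>+x. ennreal (p x) \<partial>M) = 1}"

definition supp :: "'a measure \<Rightarrow> ('a \<Rightarrow> real) \<Rightarrow> 'a set" where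
  "supp M p = {x \<in> space M. p x > 0}"

definition hellinger_sq :: "'a measure \<Rightarrow> ('a \<Rightarrow> real) \<Rightarrow> ('a \<Rightarrow> real) \<Rightarrow> real" where
  "hellinger_sq M p q = 1 / 2 * (\<integral>x. (sqrt (p x) - sqrt (q x))\<^sup>2 \<partial>M)"

(* Densities are identified when they agree almost everywhere; for counting measure this is
   equality on the whole domain. *)
definition model_class :: "'a measure \<Rightarrow> ('a \<Rightarrow> real) \<Rightarrow> ('a \<Rightarrow> real) \<Rightarrow> bool" where
  "model_class M p0 p1 \<longleftrightarrow> p0 \<in> distributions M \<and> p1 \<in> distributions M \<and>
                          \<not> (AE x in M. p0 x = p1 x)"

definition hyp0 :: "'a measure \<Rightarrow> real \<Rightarrow> ('a \<Rightarrow> real) \<Rightarrow> ('a \<Rightarrow> real) \<Rightarrow> ('a \<Rightarrow> real) \<Rightarrow> bool" where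
  "hyp0 M \<gamma> p0 p1 p \<longleftrightarrow> \<gamma> * hellinger_sq M p p0 \<le> hellinger_sq M p p1"

definition hyp1 :: "'a measure \<Rightarrow> real \<Rightarrow> ('a \<Rightarrow> real) \<Rightarrow> ('a \<Rightarrow> real) \<Rightarrow> ('a \<Rightarrow> real) \<Rightarrow> bool" where
  "hyp1 M \<gamma> p0 p1 p \<longleftrightarrow> hellinger_sq M p p0 \<ge> \<gamma> * hellinger_sq M p p1"

(* T m x is the probability of outputting p1 on the sample x 0, ..., x (m - 1). *)
definition randomized_test :: "'a measure \<Rightarrow> (nat \<Rightarrow> (nat \<Rightarrow> 'a) \<Rightarrow> real) \<Rightarrow> bool" where
  "randomized_test M T \<longleftrightarrow>
     (\<forall>m\<ge>1. T m \<in> borel_measurable (PiM {..<m} (\<lambda>_. M)) \<and>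
            (\<forall>x\<in>space (PiM {..<m} (\<lambda>_. M)). 0 \<le> T m x \<and> T m x \<le> 1))"

definition iid_samples :: "'a measure \<Rightarrow> ('a \<Rightarrow> real) \<Rightarrow> nat \<Rightarrow> (nat \<Rightarrow> 'a) measure" where
  "iid_samples M p m = PiM {..<m} (\<lambda>_. density M (\<lambda>x. ennreal (p x)))"

definition robustly_testable :: "'a measure \<Rightarrow> real \<Rightarrow> ('a \<Rightarrow> real) \<Rightarrow> ('a \<Rightarrow> real) \<Rightarrow> bool" where
  "robustly_testable M \<gamma> p0 p1 \<longleftrightarrow>
     (\<exists>T. randomized_test M T \<and>
        (\<forall>\<delta>>0. \<exists>m0. \<forall>p\<in>distributions M. \<forall>m. 1 \<le> m \<and> m0 \<le> m \<longrightarrow>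
           (hyp0 M \<gamma> p0 p1 p \<longrightarrow> (\<integral>x. 1 - T m x \<partial>iid_samples M p m) \<ge> 1 - \<delta>) \<and>
           (hyp1 M \<gamma> p0 p1 p \<longrightarrow> (\<integral>x. T m x \<partial>iid_samples M p m) \<ge> 1 - \<delta>)))"

end

(* Suppose gamma H^2(p,p0) <= H^2(p,p1) <= 1 and gamma > sqrt 2 / (sqrt 2 - 1). Then the affinity of
   p and p0 is at least 1 - 1/gamma > 1 / sqrt 2, so by AM-GM p puts mass at least
   (1 - 1/gamma)^2 > 1/2 on supp p0. By symmetry a majority vote between the two supports is a
   uniformly good test.

   For smaller gamma take the uniform densities on two unit intervals, cut into N blocks of K cells.
   Let p be half of one of them plus half of the uniform density on a random set containing one cell
   of every block of the other. Then p has affinity 1 / sqrt 2 with the first and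
   1 / sqrt (2 K) with the second, so a hypothesis holds once K is large. But m samples can only
   reveal the random set when two of them share a block, which has probability at most m^2 / N;
   otherwise they look uniform on the union, whichever interval was chosen. *)

theory Submission
  imports Defs "HOL-Real_Asymp.Real_Asymp"
begin

section \<open>Testing by majority vote\<close>

lemma distributionsD:
  assumes "p \<in> distributions M"
  shows "p \<in> borel_measurable M" "\<And>x. x \<in> space M \<Longrightarrow> 0 \<le> p x"
    "integrable M p" "(\<integral>x. p x \<partial>M) = 1" "prob_space (density M (\<lambda>x. ennreal (p x)))"
proof -
  show *: "p \<in> borel_measurable M" "\<And>x. x \<in> space M \<Longrightarrow> 0 \<le> p x"
    using assms by (auto simp: distributions_def)
  have nn: "(\<integral>\<^sup>+x. ennreal (p x) \<partial>M) = ennreal 1"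
    using assms by (simp add: distributions_def)
  then show "integrable M p"
    by (intro integrableI_nn_integral_finite[where x = 1] *) (auto simp: *)
  show "(\<integral>x. p x \<partial>M) = 1"
    using nn * by (subst integral_eq_nn_integral) (auto intro: AE_I2)
  show "prob_space (density M (\<lambda>x. ennreal (p x)))"
    using nn * by (intro prob_spaceI) (simp add: emeasure_density cong: nn_integral_cong)
qed

lemma supp_sets [measurable]:
  assumes "p \<in> borel_measurable M"
  shows "supp M p \<in> sets M"
  unfolding supp_def using assms by measurable

lemma measure_density_eq_integral:
  assumes "p \<in> distributions M" and [measurable]: "S \<in> sets M"
  shows "measure (density M (\<lambda>x. ennreal (p x))) S = (\<integral>x. indicator S x * p x \<partial>M)"
proof -
  note [measurable] = distributionsD(1)[OF assms(1)]
  have "(\<integral>x. indicator S x * p x \<partial>M) = enn2real (\<integral>\<^sup>+x. ennreal (indicator S x * p x) \<partial>M)"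
    using distributionsD(2)[OF assms(1)]
    by (intro integral_eq_nn_integral) (auto intro!: AE_I2)
  also have "(\<integral>\<^sup>+x. ennreal (indicator S x * p x) \<partial>M) = (\<integral>\<^sup>+x. ennreal (p x) * indicator S x \<partial>M)"
    by (intro nn_integral_cong) (simp split: split_indicator)
  also have "\<dots> = emeasure (density M (\<lambda>x. ennreal (p x))) S"
    by (simp add: emeasure_density)
  finally show ?thesis
    by (simp add: measure_def)
qed

lemma integrable_hellinger:
  assumes "p \<in> distributions M" "q \<in> distributions M"
  shows "integrable M (\<lambda>x. (sqrt (p x) - sqrt (q x))\<^sup>2)"
proof (rule Bochner_Integration.integrable_bound)
  note [measurable] = distributionsD(1)[OF assms(1)] distributionsD(1)[OF assms(2)]
  show "integrable M (\<lambda>x. p x + q x)"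
    using assms by (intro Bochner_Integration.integrable_add distributionsD)
  show "(\<lambda>x. (sqrt (p x) - sqrt (q x))\<^sup>2) \<in> borel_measurable M"
    by measurable
  show "AE x in M. norm ((sqrt (p x) - sqrt (q x))\<^sup>2) \<le> norm (p x + q x)"
  proof (rule AE_I2)
    fix x assume "x \<in> space M"
    then have "0 \<le> p x" "0 \<le> q x"
      using distributionsD(2)[OF assms(1)] distributionsD(2)[OF assms(2)] by auto
    then have "(sqrt (p x) - sqrt (q x))\<^sup>2 \<le> p x + q x"
      by (simp add: power2_diff)
    then show "norm ((sqrt (p x) - sqrt (q x))\<^sup>2) \<le> norm (p x + q x)"
      by simp
  qed
qed

lemma hellinger_sq_le_1:
  assumes "p \<in> distributions M" "q \<in> distributions M"
  shows "hellinger_sq M p q \<le> 1"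
proof -
  have "(\<integral>x. (sqrt (p x) - sqrt (q x))\<^sup>2 \<partial>M) \<le> (\<integral>x. p x + q x \<partial>M)"
  proof (rule integral_mono)
    fix x assume "x \<in> space M"
    then have "0 \<le> p x" "0 \<le> q x"
      using distributionsD(2)[OF assms(1)] distributionsD(2)[OF assms(2)] by auto
    then show "(sqrt (p x) - sqrt (q x))\<^sup>2 \<le> p x + q x"
      by (simp add: power2_diff)
  qed (intro integrable_hellinger Bochner_Integration.integrable_add distributionsD(3) assms)+
  also have "\<dots> = 2"
    using assms by (simp add: distributionsD)
  finally show ?thesis
    by (simp add: hellinger_sq_def)
qed

text \<open>Cauchy-Schwarz in linear form. The affinity of \<open>p\<close> and \<open>q\<close>,
  here at least \<open>a\<close>, is carried by the support of \<open>q\<close>. AM-GM with weight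
  \<open>a\<close> integrates to 2a <= w/a + a, where w is the mass of \<open>p\<close> on that
  support. The weight is the best one in the extremal case w = a^2.\<close>

lemma measure_supp_ge:
  assumes p: "p \<in> distributions M" and q: "q \<in> distributions M"
    and a: "0 < a" and H: "hellinger_sq M p q \<le> 1 - a"
  shows "a\<^sup>2 \<le> measure (density M (\<lambda>x. ennreal (p x))) (supp M q)"
proof -
  note [measurable] = distributionsD(1)[OF p] distributionsD(1)[OF q]
  define w where "w = (\<integral>x. indicator (supp M q) x * p x \<partial>M)"
  have int: "integrable M (\<lambda>x. indicator (supp M q) x * p x)"
    using integrable_mult_indicator[OF _ distributionsD(3)[OF p], of "supp M q"] by simp
  have "(\<integral>x. p x + q x - (indicator (supp M q) x * p x / a + a * q x) \<partial>M)
      \<le> (\<integral>x. (sqrt (p x) - sqrt (q x))\<^sup>2 \<partial>M)"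
  proof (rule integral_mono)
    fix x assume x: "x \<in> space M"
    have nn: "0 \<le> p x" "0 \<le> q x"
      using x distributionsD(2)[OF p] distributionsD(2)[OF q] by auto
    \<comment> \<open>AM-GM: \<open>2 sqrt (p q) \<le> p / a + a q\<close>, and the left-hand side vanishes off the support of \<open>q\<close>.\<close>
    have "2 * (sqrt (p x) * sqrt (q x)) \<le> indicator (supp M q) x * p x / a + a * q x"
    proof (cases "q x = 0")
      case True
      then show ?thesis
        using nn a by (auto simp: indicator_def)
    next
      case False
      then have "x \<in> supp M q"
        using x nn by (simp add: supp_def)
      moreover have "0 \<le> (sqrt (p x) - a * sqrt (q x))\<^sup>2 / a"
        using a by simp
      then have "2 * (sqrt (p x) * sqrt (q x)) \<le> p x / a + a * q x"
        using nn a by (simp add: power2_diff power_mult_distrib field_simps power2_eq_square)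
      ultimately show ?thesis
        by simp
    qed
    then show "p x + q x - (indicator (supp M q) x * p x / a + a * q x)
        \<le> (sqrt (p x) - sqrt (q x))\<^sup>2"
      using nn by (simp add: power2_diff)
  qed (intro integrable_hellinger Bochner_Integration.integrable_add
         Bochner_Integration.integrable_diff integrable_mult_right integrable_divide
         distributionsD(3) p q int)+
  also have "\<dots> \<le> 2 - 2 * a"
    using H by (simp add: hellinger_sq_def)
  finally have "2 - (w / a + a) \<le> 2 - 2 * a"
    using p q int by (simp add: distributionsD w_def)
  then have "a \<le> w / a"
    by simp
  then show ?thesis
    using a p q by (simp add: measure_density_eq_integral w_def power2_eq_square field_simps)
qed

section \<open>Concentration of the majority vote\<close>

lemma indep_vars_PiM_projections:
  fixes N :: "'a measure"
  assumes "prob_space N" "finite I" "I \<noteq> {}"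
  shows "prob_space.indep_vars (PiM I (\<lambda>_. N)) (\<lambda>_. N) (\<lambda>i x. x i) I"
proof -
  interpret prob_space "PiM I (\<lambda>_. N)"
    using assms by (intro prob_space_PiM)
  show ?thesis
  \<comment> \<open>Independence amounts to the joint law of the coordinates being the product of
    their laws. Restriction to \<open>I\<close> is the identity on the product space, so both sides
    equal the product measure itself.\<close>
  proof (subst indep_vars_iff_distr_eq_PiM')
    have "distr (PiM I (\<lambda>_. N)) (PiM I (\<lambda>_. N)) (\<lambda>x. \<lambda>i\<in>I. x i)
        = distr (PiM I (\<lambda>_. N)) (PiM I (\<lambda>_. N)) (\<lambda>x. x)"
      by (intro distr_cong) (auto simp: space_PiM)
    moreover have "(\<Pi>\<^sub>M i\<in>I. distr (PiM I (\<lambda>_. N)) N (\<lambda>x. x i)) = PiM I (\<lambda>_. N)"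
      using assms by (intro PiM_cong distr_PiM_component) auto
    ultimately show "distr (PiM I (\<lambda>_. N)) (PiM I (\<lambda>_. N)) (\<lambda>x. \<lambda>i\<in>I. x i)
        = (\<Pi>\<^sub>M i\<in>I. distr (PiM I (\<lambda>_. N)) N (\<lambda>x. x i))"
      by simp
  qed (use assms in auto)
qed

text \<open>Hoeffding's inequality for m independent indicators: the expected count is at least m
  (1/2 + \<eta>), so a count of at most m/2 falls short of its mean by at least m \<eta>. A generic
  \<open>S\<close> lets the bound serve the support of either model density.\<close>

lemma minority_probability_le:
  fixes N :: "'a measure"
  assumes "prob_space N" and S: "S \<in> sets N" and \<eta>: "0 \<le> \<eta>" "1 / 2 + \<eta> \<le> measure N S"
    and m: "1 \<le> m"
  shows "measure (PiM {..<m} (\<lambda>_. N))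
           {x \<in> space (PiM {..<m} (\<lambda>_. N)). 2 * (\<Sum>i<m. indicator S (x i)) \<le> real m}
         \<le> exp (- 2 * real m * \<eta>\<^sup>2)"
proof -
  let ?P = "PiM {..<m} (\<lambda>_. N)"
  interpret prob_space ?P
    using assms by (intro prob_space_PiM)
  have m': "{..<m} \<noteq> {}"
    using m by (auto simp: lessThan_empty_iff)
  have indep: "indep_vars (\<lambda>_. borel) (\<lambda>i x. indicator S (x i) :: real) {..<m}"
    using S by (intro indep_vars_compose2[OF indep_vars_PiM_projections[OF assms(1) _ m']]) auto
  have E: "expectation (\<lambda>x. indicator S (x i) :: real) = measure N S" if "i < m" for i
  proof -
    have "expectation (\<lambda>x. indicator S (x i) :: real)
        = (\<integral>x. indicator S x \<partial>distr ?P N (\<lambda>x. x i))"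
      using that S by (intro integral_distr[symmetric]) auto
    also have "distr ?P N (\<lambda>x. x i) = N"
      using that assms by (intro distr_PiM_component) auto
    finally show ?thesis
      using S sets.sets_into_space[OF S] by (simp add: Int_absorb2)
  qed
  interpret Hoeffding_ineq ?P "{..<m}" "\<lambda>i x. indicator S (x i)" "\<lambda>_. 0" "\<lambda>_. 1" "real m * measure N S"
  proof unfold_locales
    show "AE x in ?P. indicator S (x i) \<in> {0..1::real}" for i
      by (auto simp: indicator_def)
    show "real m * measure N S \<equiv> \<Sum>i<m. expectation (\<lambda>x. indicator S (x i))"
      by (rule eq_reflection) (simp add: E)
  qed (auto intro: indep)
  have "prob {x \<in> space ?P. 2 * (\<Sum>i<m. indicator S (x i)) \<le> real m}
      \<le> prob {x \<in> space ?P. (\<Sum>i<m. indicator S (x i)) \<le> real m * measure N S - real m * \<eta>}"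
  proof (rule finite_measure_mono)
    have "real m * (1 / 2) \<le> real m * (measure N S - \<eta>)"
      using \<eta> by (intro mult_left_mono) auto
    then show "{x \<in> space ?P. 2 * (\<Sum>i<m. indicator S (x i)) \<le> real m}
        \<subseteq> {x \<in> space ?P. (\<Sum>i<m. indicator S (x i)) \<le> real m * measure N S - real m * \<eta>}"
      by (auto simp: algebra_simps)
    show "{x \<in> space ?P. (\<Sum>i<m. indicator S (x i)) \<le> real m * measure N S - real m * \<eta>} \<in> events"
      using S by measurable
  qed
  also have "\<dots> \<le> exp (-2 * (real m * \<eta>)\<^sup>2 / (\<Sum>i<m. (1 - 0)\<^sup>2))"
    using \<eta> m by (intro Hoeffding_ineq_le) auto
  also have "(\<Sum>i<m. (1 - 0)\<^sup>2) = real m"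
    by simp
  also have "-2 * (real m * \<eta>)\<^sup>2 / real m = - 2 * real m * \<eta>\<^sup>2"
    using m by (simp add: power2_eq_square)
  finally show ?thesis .
qed

text \<open>An arbitrary base measure lets one proof serve counting measure and Lebesgue measure
  alike.\<close>

lemma robustly_testable_disjoint_supp:
  fixes M :: "'a measure"
  assumes \<gamma>: "\<gamma> > sqrt 2 / (sqrt 2 - 1)"
    and p0: "p0 \<in> distributions M" and p1: "p1 \<in> distributions M"
    and disj: "supp M p0 \<inter> supp M p1 = {}"
  shows "robustly_testable M \<gamma> p0 p1"
proof -
  note [measurable] = distributionsD(1)[OF p0] distributionsD(1)[OF p1]
  have "1 < sqrt 2 / (sqrt 2 - 1)"
    by (simp add: field_simps)
  then have \<gamma>1: "1 < \<gamma>"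
    using \<gamma> by linarith
  \<comment> \<open>Since H^2 is at most 1, each hypothesis puts the nearer model within 1/\<gamma>
    of \<open>p\<close>, so \<open>a\<close> is a lower bound for their affinity. The threshold on
    \<gamma> says exactly that a * sqrt 2 > 1, that is, a^2 > 1/2.\<close>
  define a where "a = 1 - 1 / \<gamma>"
  have "sqrt 2 < \<gamma> * (sqrt 2 - 1)"
    using \<gamma> by (simp add: field_simps)
  then have a2: "1 < a * sqrt 2"
    using \<gamma>1 by (simp add: a_def field_simps)
  then have a0: "0 < a"
    using mult_nonpos_nonneg[of a "sqrt 2"] by (cases "a \<le> 0") auto
  have "1\<^sup>2 < (a * sqrt 2)\<^sup>2"
    using a2 by (intro power_strict_mono) auto
  then have a12: "1 / 2 < a\<^sup>2"
    by (simp add: power_mult_distrib)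
  define \<eta> where "\<eta> = a\<^sup>2 - 1 / 2"
  have \<eta>: "0 < \<eta>"
    using a12 by (simp add: \<eta>_def)
  \<comment> \<open>\<open>q\<close> is the model near \<open>p\<close> and \<open>q'\<close> the
    other one; the two possible orders cover \<open>hyp0\<close> and \<open>hyp1\<close>.\<close>
  have mass: "1 / 2 + \<eta> \<le> measure (density M (\<lambda>x. ennreal (p x))) (supp M q)"
    if p: "p \<in> distributions M" and q: "q \<in> distributions M" and q': "q' \<in> distributions M"
      and H: "\<gamma> * hellinger_sq M p q \<le> hellinger_sq M p q'" for p q q'
  proof -
    have "\<gamma> * hellinger_sq M p q \<le> 1"
      using H hellinger_sq_le_1[OF p q'] by linarith
    then have "hellinger_sq M p q \<le> 1 - a"
      using \<gamma>1 by (simp add: a_def field_simps)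
    from measure_supp_ge[OF p q a0 this] show ?thesis
      by (simp add: \<eta>_def)
  qed
  \<comment> \<open>Points outside both supports count for \<open>p1\<close>, and a tie goes to
    \<open>p1\<close> as well. This asymmetry is harmless: each error lies in the event that the
    correct support holds at most half of the sample.\<close>
  define T :: "nat \<Rightarrow> (nat \<Rightarrow> 'a) \<Rightarrow> real"
    where "T m x = of_bool (2 * (\<Sum>i<m. indicator (supp M p0) (x i)) \<le> real m)" for m x
  have rt: "randomized_test M T"
    unfolding randomized_test_def T_def by (auto simp: of_bool_def)
  show ?thesis
    unfolding robustly_testable_def
  proof (intro exI[of _ T] conjI rt allI impI)
    fix \<delta> :: real assume \<delta>: "\<delta> > 0"
    \<comment> \<open>Here \<eta> depends on \<gamma> alone, so the sample size obtained is uniform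
      in \<open>p\<close>.\<close>
    have "(\<lambda>m. exp (- 2 * real m * \<eta>\<^sup>2)) \<longlonglongrightarrow> 0"
      using \<eta> by real_asymp
    then have "eventually (\<lambda>m. exp (- 2 * real m * \<eta>\<^sup>2) < \<delta>) sequentially"
      using \<delta> by (rule order_tendstoD)
    then obtain m0 where m0: "\<And>m. m \<ge> m0 \<Longrightarrow> exp (- 2 * real m * \<eta>\<^sup>2) < \<delta>"
      by (auto simp: eventually_sequentially)
    show "\<exists>m0. \<forall>p\<in>distributions M. \<forall>m. 1 \<le> m \<and> m0 \<le> m \<longrightarrow>
           (hyp0 M \<gamma> p0 p1 p \<longrightarrow> (\<integral>x. 1 - T m x \<partial>iid_samples M p m) \<ge> 1 - \<delta>) \<and>
           (hyp1 M \<gamma> p0 p1 p \<longrightarrow> (\<integral>x. T m x \<partial>iid_samples M p m) \<ge> 1 - \<delta>)"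
    proof (intro exI[of _ m0] ballI allI impI)
      fix p m assume p: "p \<in> distributions M" and m: "1 \<le> m \<and> m0 \<le> m"
      let ?N = "density M (\<lambda>x. ennreal (p x))"
      let ?P = "PiM {..<m} (\<lambda>_. ?N)"
      let ?R = "{x \<in> space ?P. 2 * (\<Sum>i<m. indicator (supp M p0) (x i)) \<le> real m}"
      note N = distributionsD(5)[OF p]
      interpret prob_space ?P
        using N by (intro prob_space_PiM)
      have R [measurable]: "?R \<in> events"
        by measurable
      have err: "measure ?P {x \<in> space ?P. 2 * (\<Sum>i<m. indicator S (x i)) \<le> real m} \<le> \<delta>"
        if "S \<in> sets M" "1 / 2 + \<eta> \<le> measure ?N S" for S
        using minority_probability_le[OF N, of S \<eta> m] that \<eta> m m0[of m] by auto
      have T1: "(\<integral>x. T m x \<partial>?P) = prob ?R"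
      proof -
        have "(\<integral>x. T m x \<partial>?P) = (\<integral>x. indicator ?R x \<partial>?P)"
          by (intro Bochner_Integration.integral_cong) (auto simp: T_def indicator_def)
        also have "\<dots> = prob ?R"
          by (simp add: Int_absorb2)
        finally show ?thesis .
      qed
      have T0: "(\<integral>x. 1 - T m x \<partial>?P) = 1 - prob ?R"
      proof -
        have "(\<integral>x. 1 - T m x \<partial>?P) = (\<integral>x. indicator (space ?P - ?R) x \<partial>?P)"
          by (intro Bochner_Integration.integral_cong) (auto simp: T_def indicator_def)
        also have "\<dots> = prob (space ?P - ?R)"
          by (simp add: Int_absorb2)
        finally show ?thesis
          by (simp add: prob_compl)
      qed
      show "(hyp0 M \<gamma> p0 p1 p \<longrightarrow> (\<integral>x. 1 - T m x \<partial>iid_samples M p m) \<ge> 1 - \<delta>) \<and>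
           (hyp1 M \<gamma> p0 p1 p \<longrightarrow> (\<integral>x. T m x \<partial>iid_samples M p m) \<ge> 1 - \<delta>)"
        unfolding iid_samples_def T0 T1
      proof (intro conjI impI)
        assume "hyp0 M \<gamma> p0 p1 p"
        then show "1 - \<delta> \<le> 1 - prob ?R"
          using err[of "supp M p0"] mass[OF p p0 p1] by (simp add: hyp0_def)
      next
        assume "hyp1 M \<gamma> p0 p1 p"
        then have *: "prob {x \<in> space ?P. 2 * (\<Sum>i<m. indicator (supp M p1) (x i)) \<le> real m} \<le> \<delta>"
          using err[of "supp M p1"] mass[OF p p1 p0] by (simp add: hyp1_def)
        \<comment> \<open>When the test outputs \<open>p0\<close>, more than half of the sample lies
          in the support of \<open>p0\<close>. Disjointness leaves less than half for the support of
          \<open>p1\<close>, so the error under \<open>hyp1\<close> is a minority event too.\<close>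
        have "space ?P - ?R \<subseteq> {x \<in> space ?P. 2 * (\<Sum>i<m. indicator (supp M p1) (x i)) \<le> real m}"
        proof
          fix x assume x: "x \<in> space ?P - ?R"
          have "(\<Sum>i<m. indicator (supp M p0) (x i)) + (\<Sum>i<m. indicator (supp M p1) (x i))
              = (\<Sum>i<m. indicator (supp M p0) (x i) + indicator (supp M p1) (x i) :: real)"
            by (simp add: sum.distrib)
          also have "\<dots> \<le> (\<Sum>i<m. 1)"
            using disj by (intro sum_mono) (auto simp: indicator_def)
          finally show "x \<in> {x \<in> space ?P. 2 * (\<Sum>i<m. indicator (supp M p1) (x i)) \<le> real m}"
            using x by auto
        qed
        then have "prob (space ?P - ?R)
            \<le> prob {x \<in> space ?P. 2 * (\<Sum>i<m. indicator (supp M p1) (x i)) \<le> real m}"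
          by (intro finite_measure_mono) measurable
        then show "1 - \<delta> \<le> prob ?R"
          using * prob_compl[OF R] by linarith
      qed
    qed
  qed
qed

section \<open>Indistinguishable mixtures\<close>

text \<open>Gives the sample laws of different \<open>p\<close> densities with respect to one
  product measure, so that they can be compared pointwise. The two sides agree on measurable
  rectangles, where the integral factorises.\<close>

lemma iid_samples_eq_density:
  fixes M :: "'a measure"
  assumes "sigma_finite_measure M" and p: "p \<in> distributions M"
  shows "iid_samples M p m = density (PiM {..<m} (\<lambda>_. M)) (\<lambda>x. \<Prod>i<m. ennreal (p (x i)))"
proof -
  note [measurable] = distributionsD(1)[OF p]
  let ?N = "density M (\<lambda>x. ennreal (p x))"
  interpret M: product_sigma_finite "\<lambda>_. M"
    using assms by (simp add: product_sigma_finite_def)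
  interpret N: product_sigma_finite "\<lambda>_. ?N"
    using distributionsD(5)[OF p]
    by (simp add: product_sigma_finite_def prob_space_imp_sigma_finite)
  show ?thesis
    unfolding iid_samples_def
  proof (rule N.PiM_eqI[symmetric])
    fix A :: "nat \<Rightarrow> 'a set" assume "\<And>i. i \<in> {..<m} \<Longrightarrow> A i \<in> sets ?N"
    then have A [measurable]: "A i \<in> sets M" if "i < m" for i
      using that by simp
    have [measurable]: "PiE {..<m} A \<in> sets (PiM {..<m} (\<lambda>_. M))"
      by (intro sets_PiM_I_finite) auto
    have "emeasure (density (PiM {..<m} (\<lambda>_. M)) (\<lambda>x. \<Prod>i<m. ennreal (p (x i)))) (PiE {..<m} A)
        = (\<integral>\<^sup>+x. (\<Prod>i<m. ennreal (p (x i))) * indicator (PiE {..<m} A) x \<partial>PiM {..<m} (\<lambda>_. M))"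
      by (rule emeasure_density) measurable
    also have "\<dots> = (\<integral>\<^sup>+x. (\<Prod>i<m. ennreal (p (x i)) * indicator (A i) (x i)) \<partial>PiM {..<m} (\<lambda>_. M))"
    proof (rule nn_integral_cong)
      fix x assume x: "x \<in> space (PiM {..<m} (\<lambda>_. M))"
      show "(\<Prod>i<m. ennreal (p (x i))) * indicator (PiE {..<m} A) x
          = (\<Prod>i<m. ennreal (p (x i)) * indicator (A i) (x i))"
      proof (cases "x \<in> PiE {..<m} A")
        case True
        then have "(\<Prod>i<m. ennreal (p (x i)) * indicator (A i) (x i)) = (\<Prod>i<m. ennreal (p (x i)))"
          by (intro prod.cong) (auto simp: PiE_iff)
        then show ?thesis
          using True by simp
      next
        case False
        then obtain i where "i < m" "x i \<notin> A i"
          using x by (auto simp: space_PiM PiE_iff)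
        then have "(\<Prod>i<m. ennreal (p (x i)) * indicator (A i) (x i)) = 0"
          by (intro prod_zero) (auto intro!: bexI[of _ i])
        then show ?thesis
          using False by simp
      qed
    qed
    also have "\<dots> = (\<Prod>i<m. \<integral>\<^sup>+x. ennreal (p x) * indicator (A i) x \<partial>M)"
      by (intro M.product_nn_integral_prod) auto
    also have "\<dots> = (\<Prod>i<m. emeasure ?N (A i))"
      by (intro prod.cong) (auto simp: emeasure_density)
    finally show "emeasure (density (PiM {..<m} (\<lambda>_. M)) (\<lambda>x. \<Prod>i<m. ennreal (p (x i)))) (PiE {..<m} A)
        = (\<Prod>i<m. emeasure ?N (A i))" .
  qed (auto intro!: sets_PiM_cong)
qed

text \<open>The coordinates of a uniformly random \<open>s\<close> are independent. By injectivity
  of \<beta> the factors read different coordinates, so the mean of the product is the product of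
  the means.\<close>

lemma average_prod_PiE:
  fixes g :: "nat \<Rightarrow> nat \<Rightarrow> real"
  assumes inj: "inj_on \<beta> {..<m}" and \<beta>: "\<And>i. i < m \<Longrightarrow> \<beta> i < N" and K: "0 < K"
  shows "(\<Sum>s\<in>PiE {..<N} (\<lambda>_. {..<K}). \<Prod>i<m. g i (s (\<beta> i))) / real K ^ N
       = (\<Prod>i<m. (\<Sum>k<K. g i k) / real K)"
proof -
  \<comment> \<open>\<open>f\<close> indexes the factors by the coordinate \<open>j\<close> instead
    of \<open>i\<close>, with the constant 1 at coordinates that \<beta> misses. The product then
    runs over all coordinates, and the distributive law \<open>prod_sum_PiE\<close> exchanges it
    with the sum over \<open>s\<close>.\<close>
  define f where "f j k = (if j \<in> \<beta> ` {..<m} then g (the_inv_into {..<m} \<beta> j) k else 1)" for j k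
  have f: "f (\<beta> i) k = g i k" if "i < m" for i k
    using that inj by (auto simp: f_def the_inv_into_f_f)
  have restrict: "(\<Prod>j<N. F j) = (\<Prod>i<m. F (\<beta> i))" if "\<And>j. j \<notin> \<beta> ` {..<m} \<Longrightarrow> F j = 1" for F :: "nat \<Rightarrow> real"
  proof -
    have "(\<Prod>j<N. F j) = (\<Prod>j\<in>\<beta> ` {..<m}. F j)"
      using \<beta> that by (intro prod.mono_neutral_right) auto
    then show ?thesis
      using inj by (simp add: prod.reindex)
  qed
  have "(\<Sum>s\<in>PiE {..<N} (\<lambda>_. {..<K}). \<Prod>i<m. g i (s (\<beta> i))) / real K ^ N
      = (\<Sum>s\<in>PiE {..<N} (\<lambda>_. {..<K}). \<Prod>j<N. f j (s j) / real K)"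
  proof (simp add: sum_divide_distrib prod_dividef, intro sum.cong refl)
    fix s
    have "(\<Prod>j<N. f j (s j)) = (\<Prod>i<m. f (\<beta> i) (s (\<beta> i)))"
      by (rule restrict) (simp add: f_def)
    also have "\<dots> = (\<Prod>i<m. g i (s (\<beta> i)))"
      by (intro prod.cong) (auto simp: f)
    finally show "(\<Prod>i<m. g i (s (\<beta> i))) / real K ^ N = (\<Prod>j<N. f j (s j)) / real K ^ N"
      by simp
  qed
  also have "\<dots> = (\<Prod>j<N. \<Sum>k<K. f j k / real K)"
    by (rule prod_sum_PiE[symmetric]) auto
  also have "\<dots> = (\<Prod>i<m. \<Sum>k<K. f (\<beta> i) k / real K)"
    using K by (intro restrict) (simp add: f_def)
  also have "\<dots> = (\<Prod>i<m. (\<Sum>k<K. g i k) / real K)"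
    by (intro prod.cong) (auto simp: f sum_divide_distrib)
  finally show ?thesis .
qed

section \<open>Two sets with matching grids, and their comb densities\<close>

text \<open>
  \<open>b x\<close> is the block of \<open>x\<close>, \<open>c x\<close> its cell within that block, and \<open>s\<close> selects one of the \<open>K\<close>
  cells of each block.
\<close>

definition comb_density ::
    "'a set \<Rightarrow> 'a set \<Rightarrow> ('a \<Rightarrow> nat) \<Rightarrow> ('a \<Rightarrow> nat) \<Rightarrow> nat \<Rightarrow> (nat \<Rightarrow> nat) \<Rightarrow> 'a \<Rightarrow> real" where
  "comb_density A B b c K s x =
     indicator A x / 2 + real K / 2 * indicator {x \<in> B. c x = s (b x)} x"

text \<open>Each set has mass one, spread equally over N blocks of K cells, and both sets use the
  same labels. Outside them the labels are constrained only by measurability.\<close>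

locale twin_grids =
  fixes M :: "'a measure" and A B :: "'a set" and b c :: "'a \<Rightarrow> nat" and N K :: nat
  assumes sigma_finite: "sigma_finite_measure M"
    and sets_A [measurable]: "A \<in> sets M" and sets_B [measurable]: "B \<in> sets M"
    and disjoint: "A \<inter> B = {}"
    and block [measurable]: "b \<in> measurable M (count_space UNIV)"
    and cell [measurable]: "c \<in> measurable M (count_space UNIV)"
    and block_less: "x \<in> A \<union> B \<Longrightarrow> b x < N"
    and cell_less: "x \<in> A \<union> B \<Longrightarrow> c x < K"
    and cell_A: "j < N \<Longrightarrow> k < K \<Longrightarrow>
          emeasure M {x \<in> A. b x = j \<and> c x = k} = ennreal (1 / (real N * real K))"
    and cell_B: "j < N \<Longrightarrow> k < K \<Longrightarrow>
          emeasure M {x \<in> B. b x = j \<and> c x = k} = ennreal (1 / (real N * real K))"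
    and N_pos: "0 < N" and K_pos: "0 < K"
begin

text \<open>Carries every fact proved about \<open>A\<close> over to \<open>B\<close>, and every
  fact about the comb densities over to those with the two sets exchanged.\<close>

lemma swap: "twin_grids M B A b c N K"
  using twin_grids_axioms by (auto simp: twin_grids_def)

lemma sets_Collect_A [measurable]:
  assumes [measurable]: "Measurable.pred M P"
  shows "{x \<in> A. P x} \<in> sets M"
proof -
  have "{x \<in> A. P x} = A \<inter> {x \<in> space M. P x}"
    using sets.sets_into_space[OF sets_A] by auto
  then show ?thesis
    by simp
qed

text \<open>One cell from each of N blocks, each of mass 1 / (N K). The height K / 2 in
  \<open>comb_density\<close> turns such a selection into mass 1/2.\<close>

lemma emeasure_selected_A:
  assumes s: "s \<in> PiE {..<N} (\<lambda>_. {..<K})"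
  shows "emeasure M {x \<in> A. c x = s (b x)} = ennreal (1 / real K)"
proof -
  have "{x \<in> A. c x = s (b x)} = (\<Union>j<N. {x \<in> A. b x = j \<and> c x = s j})"
    using block_less by auto
  also have "emeasure M \<dots> = (\<Sum>j<N. emeasure M {x \<in> A. b x = j \<and> c x = s j})"
    by (rule sum_emeasure[symmetric]) (auto simp: disjoint_family_on_def)
  also have "\<dots> = (\<Sum>j<N. ennreal (1 / (real N * real K)))"
    using s by (intro sum.cong cell_A) auto
  also have "\<dots> = ennreal (1 / real K)"
    using N_pos by (simp add: ennreal_of_nat_eq_real_of_nat flip: ennreal_mult)
  finally show ?thesis .
qed

lemma emeasure_block_A:
  assumes j: "j < N"
  shows "emeasure M {x \<in> A. b x = j} = ennreal (1 / real N)"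
proof -
  have "{x \<in> A. b x = j} = (\<Union>k<K. {x \<in> A. b x = j \<and> c x = k})"
    using cell_less by auto
  also have "emeasure M \<dots> = (\<Sum>k<K. emeasure M {x \<in> A. b x = j \<and> c x = k})"
    by (rule sum_emeasure[symmetric]) (auto simp: disjoint_family_on_def)
  also have "\<dots> = (\<Sum>k<K. ennreal (1 / (real N * real K)))"
    using j by (intro sum.cong cell_A) auto
  also have "\<dots> = ennreal (1 / real N)"
    using K_pos by (simp add: ennreal_of_nat_eq_real_of_nat flip: ennreal_mult)
  finally show ?thesis .
qed

lemma emeasure_A: "emeasure M A = 1"
proof -
  have "A = (\<Union>j<N. {x \<in> A. b x = j})"
    using block_less by auto
  also have "emeasure M \<dots> = (\<Sum>j<N. emeasure M {x \<in> A. b x = j})"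
    by (rule sum_emeasure[symmetric]) (auto simp: disjoint_family_on_def)
  also have "\<dots> = (\<Sum>j<N. ennreal (1 / real N))"
    by (intro sum.cong emeasure_block_A) auto
  also have "\<dots> = 1"
    using N_pos by (simp add: ennreal_of_nat_eq_real_of_nat flip: ennreal_mult)
  finally show ?thesis .
qed

lemmas sets_Collect_B [measurable] = twin_grids.sets_Collect_A[OF swap]
  and emeasure_selected_B = twin_grids.emeasure_selected_A[OF swap]
  and emeasure_block_B = twin_grids.emeasure_block_A[OF swap]
  and emeasure_B = twin_grids.emeasure_A[OF swap]

lemma selected_B_sets [measurable]: "{x \<in> B. c x = s (b x)} \<in> sets M" for s :: "nat \<Rightarrow> nat"
proof -
  have "{x \<in> B. c x = s (b x)} = (\<Union>j. {x \<in> B. b x = j \<and> c x = s j})"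
    by auto
  also have "\<dots> \<in> sets M"
    by (intro sets.countable_UN) auto
  finally show ?thesis .
qed

lemma comb_density_measurable [measurable]: "comb_density A B b c K s \<in> borel_measurable M"
  unfolding comb_density_def[abs_def]
  by (intro borel_measurable_add borel_measurable_times borel_measurable_divide
        borel_measurable_indicator borel_measurable_const sets_A selected_B_sets)

lemma comb_density_distribution:
  assumes s: "s \<in> PiE {..<N} (\<lambda>_. {..<K})"
  shows "comb_density A B b c K s \<in> distributions M"
proof -
  have "(\<integral>\<^sup>+x. ennreal (comb_density A B b c K s x) \<partial>M)
      = (\<integral>\<^sup>+x. ennreal (1 / 2) * indicator A x
            + ennreal (real K / 2) * indicator {x \<in> B. c x = s (b x)} x \<partial>M)"
    using disjoint
    by (intro nn_integral_cong)
       (auto simp: comb_density_def indicator_def simp flip: ennreal_plus)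
  also have "\<dots> = ennreal (1 / 2) + ennreal (real K / 2) * ennreal (1 / real K)"
    by (simp add: nn_integral_add nn_integral_cmult emeasure_A emeasure_selected_B[OF s])
  also have "\<dots> = ennreal (1 / 2 + real K / 2 * (1 / real K))"
    by (subst ennreal_mult[symmetric], simp, simp, subst ennreal_plus[symmetric]) auto
  also have "1 / 2 + real K / 2 * (1 / real K) = 1"
    using K_pos by simp
  finally show ?thesis
    by (simp add: distributions_def) (simp add: comb_density_def)
qed

lemma indicator_distribution: "indicator A \<in> distributions M"
  by (auto simp: distributions_def ennreal_indicator emeasure_A)

text \<open>The uniform density on the union, which has measure 2. It is the pointwise mean of
  \<open>comb_density\<close> over a uniformly random selection, and it stays the same when
  \<open>A\<close> and \<open>B\<close> are exchanged.\<close>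

definition base_density :: "'a \<Rightarrow> real" where
  "base_density x = indicator (A \<union> B) x / 2"

lemma base_density_eq: "ennreal (base_density x) = ennreal (1 / 2) * (indicator A x + indicator B x)"
  using disjoint by (auto simp: base_density_def indicator_def)

lemma base_density_measurable [measurable]: "base_density \<in> borel_measurable M"
  unfolding base_density_def[abs_def] by measurable

lemma base_density_distribution: "base_density \<in> distributions M"
proof -
  have "(\<integral>\<^sup>+x. ennreal (base_density x) \<partial>M) = ennreal (1 / 2) * (1 + 1)"
    by (simp add: base_density_eq nn_integral_cmult nn_integral_add emeasure_A emeasure_B)
  also have "\<dots> = ennreal (1 / 2) * ennreal 2"
    by simp
  also have "\<dots> = 1"
    by (subst ennreal_mult[symmetric]) auto
  finally show ?thesis
    by (auto simp: distributions_def base_density_def)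
qed

lemma base_block_probability:
  assumes j: "j < N"
  shows "emeasure (density M (\<lambda>x. ennreal (base_density x))) {x \<in> space M. b x = j} = ennreal (1 / real N)"
proof -
  have "emeasure (density M (\<lambda>x. ennreal (base_density x))) {x \<in> space M. b x = j}
      = (\<integral>\<^sup>+x. ennreal (base_density x) * indicator {x \<in> space M. b x = j} x \<partial>M)"
    by (rule emeasure_density) measurable
  also have "\<dots> = (\<integral>\<^sup>+x. ennreal (1 / 2) * (indicator {x \<in> A. b x = j} x + indicator {x \<in> B. b x = j} x) \<partial>M)"
    by (intro nn_integral_cong) (auto simp: base_density_eq indicator_def)
  also have "\<dots> = ennreal (1 / 2) * (ennreal (1 / real N) + ennreal (1 / real N))"
    by (simp add: nn_integral_cmult nn_integral_add emeasure_block_A[OF j] emeasure_block_B[OF j])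
  also have "\<dots> = ennreal (1 / 2 * (1 / real N + 1 / real N))"
    by (simp only: ennreal_mult ennreal_plus zero_le_divide_1_iff of_nat_0_le_iff zero_le_numeral add_nonneg_nonneg)
  finally show ?thesis
    by simp
qed

text \<open>Absence of a birthday collision. On this event a sample inside the two sets reads m
  different coordinates of the selection, as \<open>average_prod_PiE\<close> requires.\<close>

definition distinct_blocks :: "nat \<Rightarrow> (nat \<Rightarrow> 'a) set" where
  "distinct_blocks m = {x \<in> space (PiM {..<m} (\<lambda>_. M)). inj_on (\<lambda>i. b (x i)) {..<m}}"

lemma distinct_blocks_sets [measurable]: "distinct_blocks m \<in> sets (PiM {..<m} (\<lambda>_. M))"
proof -
  have "distinct_blocks m =
      {x \<in> space (PiM {..<m} (\<lambda>_. M)). \<forall>i\<in>{..<m}. \<forall>j\<in>{..<m}. b (x i) = b (x j) \<longrightarrow> i = j}"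
    by (auto simp: distinct_blocks_def inj_on_def)
  also have "\<dots> \<in> sets (PiM {..<m} (\<lambda>_. M))"
    by measurable
  finally show ?thesis .
qed

text \<open>
  Off \<open>A \<union> B\<close> the left-hand side vanishes; on it equality holds, because the uniformly random
  selections in distinct blocks are independent.
\<close>

lemma average_comb_density:
  assumes x: "x \<in> distinct_blocks m"
  shows "(\<Prod>i<m. ennreal (base_density (x i)))
       \<le> (\<Sum>s\<in>PiE {..<N} (\<lambda>_. {..<K}).
            ennreal (1 / real K ^ N) * (\<Prod>i<m. ennreal (comb_density A B b c K s (x i))))"
proof (cases "\<forall>i<m. x i \<in> A \<union> B")
  case False
  then obtain i where "i < m" "x i \<notin> A \<union> B"
    by blast
  then have "(\<Prod>i<m. ennreal (base_density (x i))) = 0"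
    by (intro prod_zero) (auto simp: base_density_def intro!: bexI[of _ i])
  then show ?thesis
    by (simp only: zero_le)
next
  case True
  \<comment> \<open>At \<open>x i\<close> the comb density depends on \<open>s\<close> only through
    \<open>s (b (x i))\<close>. \<open>g\<close> makes that value an argument, in the form that
    \<open>average_prod_PiE\<close> expects.\<close>
  define g where "g i k = indicator A (x i) / 2 + real K / 2 * (indicator B (x i) * of_bool (c (x i) = k))"
    for i k
  have nn: "0 \<le> comb_density A B b c K s y" for s y
    by (simp add: comb_density_def)
  have g: "comb_density A B b c K s (x i) = g i (s (b (x i)))" for s i
    by (simp add: comb_density_def g_def indicator_def)
  \<comment> \<open>Exactly one \<open>k\<close> matches the cell of \<open>x i\<close>, so on
    \<open>B\<close> the height K / 2 averages to 1/2, which is the constant value on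
    \<open>A\<close>.\<close>
  have mean: "(\<Sum>k<K. g i k) / real K = base_density (x i)" if "i < m" for i
  proof -
    have "c (x i) < K"
      using True that cell_less by auto
    then have "(\<Sum>k<K. of_bool (c (x i) = k)) = (1 :: real)"
      by (simp add: of_bool_def)
    moreover have "(\<Sum>k<K. g i k) = real K * (indicator A (x i) / 2)
        + real K / 2 * (indicator B (x i) * (\<Sum>k<K. of_bool (c (x i) = k)))"
      by (simp only: g_def sum.distrib sum_distrib_left sum_constant card_lessThan)
    ultimately have "(\<Sum>k<K. g i k) = real K * (indicator A (x i) / 2) + real K / 2 * indicator B (x i)"
      by simp
    then show ?thesis
      using K_pos disjoint by (auto simp: base_density_def indicator_def)
  qed
  have "(\<Prod>i<m. base_density (x i)) = (\<Prod>i<m. (\<Sum>k<K. g i k) / real K)"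
    by (simp add: mean)
  also have "\<dots> = (\<Sum>s\<in>PiE {..<N} (\<lambda>_. {..<K}). \<Prod>i<m. g i (s (b (x i)))) / real K ^ N"
    using x True block_less K_pos
    by (intro average_prod_PiE[symmetric]) (auto simp: distinct_blocks_def)
  also have "\<dots> = (\<Sum>s\<in>PiE {..<N} (\<lambda>_. {..<K}).
      1 / real K ^ N * (\<Prod>i<m. comb_density A B b c K s (x i)))"
    by (simp add: g sum_divide_distrib)
  finally have eq: "(\<Prod>i<m. base_density (x i)) = \<dots>" .
  have "(\<Prod>i<m. ennreal (base_density (x i))) = ennreal (\<Prod>i<m. base_density (x i))"
    by (intro prod_ennreal) (simp add: base_density_def)
  also have "\<dots> = (\<Sum>s\<in>PiE {..<N} (\<lambda>_. {..<K}).
      ennreal (1 / real K ^ N * (\<Prod>i<m. comb_density A B b c K s (x i))))"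
    unfolding eq by (intro sum_ennreal[symmetric]) (simp add: nn prod_nonneg)
  also have "\<dots> = (\<Sum>s\<in>PiE {..<N} (\<lambda>_. {..<K}).
            ennreal (1 / real K ^ N) * (\<Prod>i<m. ennreal (comb_density A B b c K s (x i))))"
    by (intro sum.cong refl) (simp only: nn prod_ennreal prod_nonneg ennreal_mult[symmetric] zero_le_divide_1_iff zero_le_power of_nat_0_le_iff)
  finally show ?thesis
    by simp
qed

text \<open>A bound valid for every selection holds for the mean over selections, which dominates
  the uniform sample density on \<open>distinct_blocks\<close>. So it passes to uniform samples
  without a collision.\<close>

lemma nn_integral_base_le:
  assumes f [measurable]: "f \<in> borel_measurable (PiM {..<m} (\<lambda>_. M))"
    and bound: "\<And>s. s \<in> PiE {..<N} (\<lambda>_. {..<K}) \<Longrightarrow>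
      (\<integral>\<^sup>+x. f x \<partial>iid_samples M (comb_density A B b c K s) m) \<le> ennreal \<delta>"
    and \<delta>: "0 \<le> \<delta>"
  shows "(\<integral>\<^sup>+x. f x * indicator (distinct_blocks m) x \<partial>iid_samples M base_density m) \<le> ennreal \<delta>"
proof -
  let ?S = "PiE {..<N} (\<lambda>_. {..<K})"
  let ?Q = "PiM {..<m} (\<lambda>_. M)"
  define w where "w = ennreal (1 / real K ^ N)"
  define h where "h s x = (\<Prod>i<m. ennreal (comb_density A B b c K s (x i)))" for s and x :: "nat \<Rightarrow> 'a"
  have [measurable]: "h s \<in> borel_measurable ?Q" for s
    unfolding h_def by measurable
  have "(\<integral>\<^sup>+x. f x * indicator (distinct_blocks m) x \<partial>iid_samples M base_density m)
      = (\<integral>\<^sup>+x. (\<Prod>i<m. ennreal (base_density (x i))) * (f x * indicator (distinct_blocks m) x) \<partial>?Q)"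
    unfolding iid_samples_eq_density[OF sigma_finite base_density_distribution]
    by (rule nn_integral_density) measurable
  also have "\<dots> \<le> (\<integral>\<^sup>+x. (\<Sum>s\<in>?S. w * (h s x * f x)) \<partial>?Q)"
  proof (rule nn_integral_mono)
    fix x
    show "(\<Prod>i<m. ennreal (base_density (x i))) * (f x * indicator (distinct_blocks m) x)
        \<le> (\<Sum>s\<in>?S. w * (h s x * f x))"
    proof (cases "x \<in> distinct_blocks m")
      case True
      then have "(\<Prod>i<m. ennreal (base_density (x i))) * f x \<le> (\<Sum>s\<in>?S. w * h s x) * f x"
        unfolding w_def h_def by (intro mult_right_mono average_comb_density) auto
      then show ?thesis
        using True by (simp add: sum_distrib_right mult.assoc)
    qed auto
  qed
  also have "\<dots> = (\<Sum>s\<in>?S. w * (\<integral>\<^sup>+x. h s x * f x \<partial>?Q))"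
    by (simp add: nn_integral_sum nn_integral_cmult)
  also have "\<dots> = (\<Sum>s\<in>?S. w * (\<integral>\<^sup>+x. f x \<partial>iid_samples M (comb_density A B b c K s) m))"
    unfolding h_def
    by (intro sum.cong refl)
       (simp add: iid_samples_eq_density[OF sigma_finite comb_density_distribution] nn_integral_density)
  also have "\<dots> \<le> (\<Sum>s\<in>?S. w * ennreal \<delta>)"
    using bound by (intro sum_mono mult_left_mono) auto
  also have "\<dots> = ennreal (real K ^ N) * (w * ennreal \<delta>)"
    by (simp add: card_PiE ennreal_of_nat_eq_real_of_nat)
  also have "\<dots> = ennreal \<delta>"
    using K_pos \<delta> by (simp add: w_def flip: ennreal_mult)
  finally show ?thesis .
qed

text \<open>Birthday bound: there are at most m^2 ordered pairs of different sample indices, and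
  each pair shares a block with probability at most 1/N.\<close>

lemma distinct_blocks_probability:
  "1 - (real m)\<^sup>2 / real N \<le> measure (iid_samples M base_density m) (distinct_blocks m)"
proof -
  let ?N = "density M (\<lambda>x. ennreal (base_density x))"
  let ?P = "iid_samples M base_density m"
  have N: "prob_space ?N"
    by (rule distributionsD[OF base_density_distribution])
  interpret P: product_prob_space "\<lambda>_. ?N" "{..<m}"
    using N by (simp add: product_prob_space_def product_prob_space_axioms_def product_sigma_finite_def prob_space_imp_sigma_finite)
  have P: "?P = PiM {..<m} (\<lambda>_. ?N)"
    by (simp add: iid_samples_def)
  interpret prob_space ?P
    unfolding P using N by (intro prob_space_PiM)
  have sets_P [measurable_cong]: "sets ?P = sets (PiM {..<m} (\<lambda>_. M))"
    unfolding P by (intro sets_PiM_cong) auto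
  have space_P: "space ?P = space (PiM {..<m} (\<lambda>_. M))"
    using sets_P by (rule sets_eq_imp_space_eq)
  define I where "I = {(i, j) \<in> {..<m} \<times> {..<m}. i \<noteq> j}"
  have I: "finite I" "card I \<le> m\<^sup>2"
  proof -
    have "I \<subseteq> {..<m} \<times> {..<m}"
      by (auto simp: I_def)
    then show "finite I" "card I \<le> m\<^sup>2"
      using card_mono[of "{..<m} \<times> {..<m}" I] finite_subset[of I "{..<m} \<times> {..<m}"]
      by (auto simp: power2_eq_square)
  qed
  \<comment> \<open>The collision of one pair, split by the common block \<open>k\<close>.
    Quantifying over a set of indices fits \<open>emeasure_PiM_Collect\<close>; for pairs in
    \<open>I\<close> the two indices differ, so each \<open>k\<close> contributes 1/N^2.\<close>
  define E where "E ij = (\<Union>k<N. {x \<in> space ?P. \<forall>l\<in>{fst ij, snd ij}. x l \<in> {y \<in> space M. b y = k}})"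
    for ij :: "nat \<times> nat"
  have E_sets [measurable]: "{x \<in> space ?P. \<forall>l\<in>{fst ij, snd ij}. x l \<in> {y \<in> space M. b y = k}} \<in> events"
    if "ij \<in> I" for ij k
  proof -
    have [measurable]: "fst ij \<in> {..<m}" "snd ij \<in> {..<m}"
      using that by (auto simp: I_def)
    then have "{x \<in> space ?P. \<forall>l\<in>{fst ij, snd ij}. x l \<in> {y \<in> space M. b y = k}}
        = {x \<in> space (PiM {..<m} (\<lambda>_. M)). b (x (fst ij)) = k \<and> b (x (snd ij)) = k}"
      by (auto simp: space_P space_PiM PiE_iff)
    also have "\<dots> \<in> events"
      unfolding sets_P by measurable
    finally show ?thesis .
  qed
  have E_events: "E ij \<in> events" if "ij \<in> I" for ij
    unfolding E_def using that by (intro sets.finite_UN finite_lessThan E_sets)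
  have E_prob: "prob (E ij) \<le> 1 / real N" if ij: "ij \<in> I" for ij
  proof -
    have "prob (E ij) \<le> (\<Sum>k<N. prob {x \<in> space ?P. \<forall>l\<in>{fst ij, snd ij}. x l \<in> {y \<in> space M. b y = k}})"
      unfolding E_def using ij by (intro measure_UNION_le E_sets finite_lessThan)
    also have "\<dots> = (\<Sum>k<N. 1 / (real N)\<^sup>2)"
    proof (rule sum.cong)
      fix k assume k: "k \<in> {..<N}"
      have "emeasure ?P {x \<in> space ?P. \<forall>l\<in>{fst ij, snd ij}. x l \<in> {y \<in> space M. b y = k}}
          = (\<Prod>l\<in>{fst ij, snd ij}. emeasure ?N {y \<in> space M. b y = k})"
        unfolding P using ij by (intro P.emeasure_PiM_Collect) (auto simp: I_def)
      also have "\<dots> = ennreal (1 / real N) * ennreal (1 / real N)"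
        using ij k by (auto simp: I_def base_block_probability)
      also have "\<dots> = ennreal (1 / (real N)\<^sup>2)"
        by (simp add: power2_eq_square flip: ennreal_mult)
      finally show "prob {x \<in> space ?P. \<forall>l\<in>{fst ij, snd ij}. x l \<in> {y \<in> space M. b y = k}} = 1 / (real N)\<^sup>2"
        by (simp add: measure_def)
    qed simp
    also have "\<dots> = 1 / real N"
      using N_pos by (simp add: power2_eq_square)
    finally show ?thesis .
  qed
  \<comment> \<open>Outside \<open>A \<union> B\<close> a block label may be N or larger and escape
    every \<open>E ij\<close>. The base density vanishes there, so the inclusion in the union holds
    almost everywhere.\<close>
  have AE_N: "AE y in ?N. y \<in> A \<union> B"
    by (subst AE_density) (auto simp: base_density_def indicator_def)
  have "AE x in ?P. \<forall>i\<in>{..<m}. x i \<in> A \<union> B"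
    unfolding P using N AE_N
    by (intro AE_finite_allI AE_PiM_component[where P = "\<lambda>y. y \<in> A \<union> B"]) auto
  then have "prob (space ?P - distinct_blocks m) \<le> prob (\<Union>ij\<in>I. E ij)"
  proof (intro finite_measure_mono_AE)
    assume "AE x in ?P. \<forall>i\<in>{..<m}. x i \<in> A \<union> B"
    then show "AE x in ?P. x \<in> space ?P - distinct_blocks m \<longrightarrow> x \<in> (\<Union>ij\<in>I. E ij)"
    proof eventually_elim
      fix x assume x: "\<forall>i\<in>{..<m}. x i \<in> A \<union> B"
      show "x \<in> space ?P - distinct_blocks m \<longrightarrow> x \<in> (\<Union>ij\<in>I. E ij)"
      proof
        assume "x \<in> space ?P - distinct_blocks m"
        then obtain i j where ij: "i < m" "j < m" "i \<noteq> j" "b (x i) = b (x j)" and xs: "x \<in> space ?P"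
          by (auto simp: distinct_blocks_def space_P inj_on_def)
        then have "b (x i) < N" "x i \<in> space M" "x j \<in> space M"
          using x block_less xs by (auto simp: space_P space_PiM)
        then have "x \<in> E (i, j)"
          using ij xs by (auto simp: E_def)
        then show "x \<in> (\<Union>ij\<in>I. E ij)"
          using ij by (auto simp: I_def)
      qed
    qed
  next
    show "(\<Union>ij\<in>I. E ij) \<in> events"
      using I(1) by (intro sets.finite_UN E_events)
  qed
  also have "\<dots> \<le> (\<Sum>ij\<in>I. prob (E ij))"
    using I(1) by (intro measure_UNION_le E_events)
  also have "\<dots> \<le> real (card I) * (1 / real N)"
    using E_prob by (rule sum_bounded_above)
  also have "\<dots> \<le> (real m)\<^sup>2 * (1 / real N)"
    using I(2) by (intro mult_right_mono) (auto simp flip: of_nat_power)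
  finally have "prob (space ?P - distinct_blocks m) \<le> (real m)\<^sup>2 / real N"
    by simp
  moreover have "prob (space ?P - distinct_blocks m) = 1 - prob (distinct_blocks m)"
    by (intro prob_compl) measurable
  ultimately show ?thesis
    by linarith
qed

section \<open>Hellinger distances of the comb densities\<close>

lemma has_bochner_integral_selected_B:
  assumes s: "s \<in> PiE {..<N} (\<lambda>_. {..<K})"
  shows "has_bochner_integral M (indicator {x \<in> B. c x = s (b x)}) (1 / real K)"
  using has_bochner_integral_real_indicator[OF selected_B_sets[of s]] emeasure_selected_B[OF s]
  by (simp add: measure_def)

lemma has_bochner_integral_A: "has_bochner_integral M (indicator A) (1::real)"
  using has_bochner_integral_real_indicator[of A M] emeasure_A by (simp add: measure_def)

lemmas has_bochner_integral_B = twin_grids.has_bochner_integral_A[OF swap]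

text \<open>\<open>A\<close> contributes (1 / sqrt 2 - 1)^2 and the selected cells K / 2 * (1 / K),
  in sum 2 - sqrt 2, whatever K is.\<close>

lemma hellinger_sq_comb_A:
  assumes s: "s \<in> PiE {..<N} (\<lambda>_. {..<K})"
  shows "hellinger_sq M (comb_density A B b c K s) (indicator A) = 1 - 1 / sqrt 2"
proof -
  let ?C = "{x \<in> B. c x = s (b x)}"
  have sq: "(sqrt (real K) / sqrt 2)\<^sup>2 = real K / 2"
    by (simp add: power_divide)
  have "has_bochner_integral M (\<lambda>x. (1 / sqrt 2 - 1)\<^sup>2 * indicator A x + real K / 2 * indicator ?C x)
      ((1 / sqrt 2 - 1)\<^sup>2 * 1 + real K / 2 * (1 / real K))"
    by (intro has_bochner_integral_add has_bochner_integral_mult_right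
          has_bochner_integral_A has_bochner_integral_selected_B s)
  moreover have "(1 / sqrt 2 - 1)\<^sup>2 * indicator A x + real K / 2 * indicator ?C x
      = (sqrt (comb_density A B b c K s x) - sqrt (indicator A x))\<^sup>2" for x
    using disjoint by (auto simp: comb_density_def indicator_def real_sqrt_divide sq)
  ultimately have "(\<integral>x. (sqrt (comb_density A B b c K s x) - sqrt (indicator A x))\<^sup>2 \<partial>M)
      = (1 / sqrt 2 - 1)\<^sup>2 * 1 + real K / 2 * (1 / real K)"
    by (simp add: has_bochner_integral_integral_eq)
  also have "\<dots> = 2 * (1 - 1 / sqrt 2)"
    using K_pos by (simp add: power2_diff power_divide)
  finally show ?thesis
    by (simp add: hellinger_sq_def)
qed

text \<open>The comb meets \<open>B\<close> only in tall, narrow cells. The affinity is sqrt (K / 2)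
  * (1 / K), so the distance tends to 1 as K grows.\<close>

lemma hellinger_sq_comb_B:
  assumes s: "s \<in> PiE {..<N} (\<lambda>_. {..<K})"
  shows "hellinger_sq M (comb_density A B b c K s) (indicator B) = 1 - 1 / sqrt (2 * real K)"
proof -
  let ?C = "{x \<in> B. c x = s (b x)}"
  have sq: "(sqrt (real K) / sqrt 2)\<^sup>2 = real K / 2" "(1 / sqrt 2)\<^sup>2 = (1 / 2 :: real)"
    by (simp_all add: power_divide)
  \<comment> \<open>On \<open>B\<close> the integrand is 1 except on \<open>?C\<close>. Writing it
    as \<open>indicator B\<close> plus a correction on \<open>?C\<close> avoids integrating over the
    difference of the two sets.\<close>
  have "has_bochner_integral M
      (\<lambda>x. 1 / 2 * indicator A x + indicator B x + ((sqrt (real K / 2) - 1)\<^sup>2 - 1) * indicator ?C x)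
      (1 / 2 * 1 + 1 + ((sqrt (real K / 2) - 1)\<^sup>2 - 1) * (1 / real K))"
    by (intro has_bochner_integral_add has_bochner_integral_mult_right
          has_bochner_integral_A has_bochner_integral_B has_bochner_integral_selected_B s)
  moreover have "1 / 2 * indicator A x + indicator B x + ((sqrt (real K / 2) - 1)\<^sup>2 - 1) * indicator ?C x
      = (sqrt (comb_density A B b c K s x) - sqrt (indicator B x))\<^sup>2" for x
    using disjoint by (auto simp: comb_density_def indicator_def real_sqrt_divide sq)
  ultimately have "(\<integral>x. (sqrt (comb_density A B b c K s x) - sqrt (indicator B x))\<^sup>2 \<partial>M)
      = 1 / 2 * 1 + 1 + ((sqrt (real K / 2) - 1)\<^sup>2 - 1) * (1 / real K)"
    by (simp add: has_bochner_integral_integral_eq)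
  also have "\<dots> = 2 - 2 * (sqrt (real K / 2) / real K)"
    using K_pos by (simp add: power2_diff field_simps)
  also have "sqrt (real K / 2) / real K = 1 / sqrt (2 * real K)"
    using K_pos by (simp add: real_sqrt_divide real_sqrt_mult field_simps)
  finally show ?thesis
    by (simp add: hellinger_sq_def)
qed

end

section \<open>Contradiction from the two mixtures\<close>

lemma nn_integral_le_error:
  assumes "prob_space P" and [measurable]: "f \<in> borel_measurable P"
    and range: "\<And>x. x \<in> space P \<Longrightarrow> 0 \<le> f x \<and> f x \<le> (1 :: real)"
    and err: "1 - \<delta> \<le> (\<integral>x. 1 - f x \<partial>P)"
  shows "(\<integral>\<^sup>+x. ennreal (f x) \<partial>P) \<le> ennreal \<delta>"
proof -
  interpret prob_space P by fact
  have int: "integrable P f"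
    using range by (intro integrable_const_bound[where B = 1] AE_I2) auto
  have "(\<integral>x. 1 - f x \<partial>P) = 1 - (\<integral>x. f x \<partial>P)"
    using int by (simp add: prob_space)
  moreover have "(\<integral>\<^sup>+x. ennreal (f x) \<partial>P) = ennreal (\<integral>x. f x \<partial>P)"
    using int range by (intro nn_integral_eq_integral AE_I2) auto
  ultimately show ?thesis
    using err by (auto intro!: ennreal_leI)
qed

lemma iid_samples_prob_space:
  assumes "p \<in> distributions M"
  shows "prob_space (iid_samples M p m)"
  unfolding iid_samples_def using distributionsD(5)[OF assms] by (intro prob_space_PiM)

lemma sets_iid_samples [measurable_cong]: "sets (iid_samples M p m) = sets (PiM {..<m} (\<lambda>_. M))"
  unfolding iid_samples_def by (intro sets_PiM_cong) auto

lemma space_iid_samples: "space (iid_samples M p m) = space (PiM {..<m} (\<lambda>_. M))"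
  by (rule sets_eq_imp_space_eq[OF sets_iid_samples])

context twin_grids
begin

lemma comb_density_hyp0:
  assumes "\<gamma> * (1 - 1 / sqrt 2) \<le> 1 - 1 / sqrt (2 * real K)"
    and "s \<in> PiE {..<N} (\<lambda>_. {..<K})"
  shows "hyp0 M \<gamma> (indicator A) (indicator B) (comb_density A B b c K s)"
  using assms by (simp add: hyp0_def hellinger_sq_comb_A hellinger_sq_comb_B)

lemma comb_density_hyp1:
  assumes "\<gamma> * (1 - 1 / sqrt 2) \<le> 1 - 1 / sqrt (2 * real K)"
    and "s \<in> PiE {..<N} (\<lambda>_. {..<K})"
  shows "hyp1 M \<gamma> (indicator A) (indicator B) (comb_density B A b c K s)"
  using twin_grids.comb_density_hyp0[OF swap assms] by (simp add: hyp0_def hyp1_def)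

text \<open>Le Cam's method with a mixture on each side. Without a collision both mixtures dominate
  uniform sampling, so there \<open>T\<close> and \<open>1 - T\<close> each integrate to at most
  1/4. Together they give the probability of having no collision, which is at least 3/4 because N is
  at least 4 m^2.\<close>

lemma no_uniform_test:
  assumes T [measurable]: "T \<in> borel_measurable (PiM {..<m} (\<lambda>_. M))"
    and range: "\<And>x. x \<in> space (PiM {..<m} (\<lambda>_. M)) \<Longrightarrow> 0 \<le> T x \<and> T x \<le> (1 :: real)"
    and N: "4 * m\<^sup>2 \<le> N"
    and A: "\<And>s. s \<in> PiE {..<N} (\<lambda>_. {..<K}) \<Longrightarrow>
      1 - 1 / 4 \<le> (\<integral>x. 1 - T x \<partial>iid_samples M (comb_density A B b c K s) m)"
    and B: "\<And>s. s \<in> PiE {..<N} (\<lambda>_. {..<K}) \<Longrightarrow>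
      1 - 1 / 4 \<le> (\<integral>x. T x \<partial>iid_samples M (comb_density B A b c K s) m)"
  shows False
proof -
  let ?U = "iid_samples M base_density m"
  let ?D = "distinct_blocks m"
  have T_err: "(\<integral>\<^sup>+x. ennreal (T x) \<partial>iid_samples M (comb_density A B b c K s) m) \<le> ennreal (1 / 4)"
    if s: "s \<in> PiE {..<N} (\<lambda>_. {..<K})" for s
    using A[OF s] range
    by (intro nn_integral_le_error iid_samples_prob_space comb_density_distribution s)
       (auto simp: space_iid_samples)
  have T'_err: "(\<integral>\<^sup>+x. ennreal (1 - T x) \<partial>iid_samples M (comb_density B A b c K s) m) \<le> ennreal (1 / 4)"
    if s: "s \<in> PiE {..<N} (\<lambda>_. {..<K})" for s
    using B[OF s] range
    by (intro nn_integral_le_error iid_samples_prob_space twin_grids.comb_density_distribution[OF swap] s)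
       (auto simp: space_iid_samples)
  \<comment> \<open>Both orientations share their mean, and \<open>distinct_blocks\<close> refers
    only to \<open>M\<close> and \<open>b\<close>. Hence \<open>U1\<close> and \<open>U2\<close>
    concern the same measure and the same event.\<close>
  have base_swap: "twin_grids.base_density B A = base_density"
    by (simp add: fun_eq_iff base_density_def twin_grids.base_density_def[OF swap] Un_commute)
  have U1: "(\<integral>\<^sup>+x. ennreal (T x) * indicator ?D x \<partial>?U) \<le> ennreal (1 / 4)"
    by (intro nn_integral_base_le T_err) auto
  have U2: "(\<integral>\<^sup>+x. ennreal (1 - T x) * indicator ?D x \<partial>?U) \<le> ennreal (1 / 4)"
    using twin_grids.nn_integral_base_le[OF swap, of "\<lambda>x. ennreal (1 - T x)" m "1 / 4"] T'_err
    by (simp add: base_swap)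
  interpret prob_space ?U
    by (rule iid_samples_prob_space[OF base_density_distribution])
  have "emeasure ?U ?D = (\<integral>\<^sup>+x. indicator ?D x \<partial>?U)"
    by (rule nn_integral_indicator[symmetric]) measurable
  also have "\<dots> = (\<integral>\<^sup>+x. ennreal (T x) * indicator ?D x + ennreal (1 - T x) * indicator ?D x \<partial>?U)"
  proof (rule nn_integral_cong)
    fix x assume "x \<in> space ?U"
    then have "ennreal (T x) + ennreal (1 - T x) = 1"
      using range[of x] by (simp add: space_iid_samples flip: ennreal_plus)
    then show "indicator ?D x = ennreal (T x) * indicator ?D x + ennreal (1 - T x) * indicator ?D x"
      by (simp flip: distrib_right)
  qed
  also have "\<dots> = (\<integral>\<^sup>+x. ennreal (T x) * indicator ?D x \<partial>?U) + (\<integral>\<^sup>+x. ennreal (1 - T x) * indicator ?D x \<partial>?U)"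
    by (rule nn_integral_add) measurable
  also have "\<dots> \<le> ennreal (1 / 4) + ennreal (1 / 4)"
    by (intro add_mono U1 U2)
  also have "\<dots> = ennreal (1 / 2)"
    by (subst ennreal_plus[symmetric]) auto
  finally have "prob ?D \<le> 1 / 2"
    unfolding emeasure_eq_measure by (subst (asm) ennreal_le_iff) auto
  moreover have "(real m)\<^sup>2 / real N \<le> 1 / 4"
  proof -
    have "real (4 * m\<^sup>2) \<le> real N"
      using N by (simp only: of_nat_le_iff)
    then show ?thesis
      using N_pos by (simp add: field_simps)
  qed
  ultimately show False
    using distinct_blocks_probability[of m] by linarith
qed

end

text \<open>The sets are fixed while N is free: the model class must not depend on N, which is
  chosen after the test and its sample size are known.\<close>

lemma not_robustly_testable_twin_grids:
  fixes M :: "'a measure"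
  assumes grids: "\<And>N. 0 < N \<Longrightarrow> \<exists>b c. twin_grids M A B b c N K"
    and \<gamma>: "\<gamma> * (1 - 1 / sqrt 2) \<le> 1 - 1 / sqrt (2 * real K)"
  shows "\<not> robustly_testable M \<gamma> (indicator A) (indicator B)"
proof
  assume "robustly_testable M \<gamma> (indicator A) (indicator B)"
  then obtain T where T: "randomized_test M T"
    and test: "\<And>\<delta>. \<delta> > 0 \<Longrightarrow> \<exists>m0. \<forall>p\<in>distributions M. \<forall>m. 1 \<le> m \<and> m0 \<le> m \<longrightarrow>
           (hyp0 M \<gamma> (indicator A) (indicator B) p \<longrightarrow> (\<integral>x. 1 - T m x \<partial>iid_samples M p m) \<ge> 1 - \<delta>) \<and>
           (hyp1 M \<gamma> (indicator A) (indicator B) p \<longrightarrow> (\<integral>x. T m x \<partial>iid_samples M p m) \<ge> 1 - \<delta>)"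
    unfolding robustly_testable_def by blast
  obtain m0 where m0: "\<And>p m. p \<in> distributions M \<Longrightarrow> 1 \<le> m \<Longrightarrow> m0 \<le> m \<Longrightarrow>
           (hyp0 M \<gamma> (indicator A) (indicator B) p \<longrightarrow> (\<integral>x. 1 - T m x \<partial>iid_samples M p m) \<ge> 1 - 1 / 4) \<and>
           (hyp1 M \<gamma> (indicator A) (indicator B) p \<longrightarrow> (\<integral>x. T m x \<partial>iid_samples M p m) \<ge> 1 - 1 / 4)"
    using test[of "1 / 4"] by auto
  define m where "m = Suc m0"
  have m: "1 \<le> m" "m0 \<le> m"
    by (auto simp: m_def)
  \<comment> \<open>With 4 m^2 blocks, m samples collide with probability at most 1/4.\<close>
  obtain b c where "twin_grids M A B b c (4 * m\<^sup>2) K"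
    using grids[of "4 * m\<^sup>2"] m by auto
  then interpret twin_grids M A B b c "4 * m\<^sup>2" K .
  show False
  proof (rule no_uniform_test[of "T m" m])
    fix s assume s: "s \<in> PiE {..<4 * m\<^sup>2} (\<lambda>_. {..<K})"
    show "1 - 1 / 4 \<le> (\<integral>x. 1 - T m x \<partial>iid_samples M (comb_density A B b c K s) m)"
      using m0[OF comb_density_distribution[OF s] m] comb_density_hyp0[OF \<gamma> s] by blast
    show "1 - 1 / 4 \<le> (\<integral>x. T m x \<partial>iid_samples M (comb_density B A b c K s) m)"
      using m0[OF twin_grids.comb_density_distribution[OF swap s] m] comb_density_hyp1[OF \<gamma> s] by blast
  qed (use T m in \<open>auto simp: randomized_test_def\<close>)
qed

section \<open>Realisation by two unit intervals of the real line\<close>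

definition unit_slab :: "int \<Rightarrow> (nat \<Rightarrow> real) set" where
  "unit_slab e = {x \<in> space (lebesgue_Rd 1). x 0 \<in> {of_int e..<of_int e + 1}}"

lemma sigma_finite_lebesgue_Rd: "sigma_finite_measure (lebesgue_Rd d)"
proof -
  interpret product_sigma_finite "\<lambda>_::nat. lborel :: real measure"
    by (simp add: product_sigma_finite_def lborel.sigma_finite_measure_axioms)
  show ?thesis
    unfolding lebesgue_Rd_def by (rule sigma_finite) simp
qed

lemma measurable_lebesgue_Rd_1 [measurable]: "(\<lambda>x. x 0) \<in> borel_measurable (lebesgue_Rd 1)"
  unfolding lebesgue_Rd_def by measurable

lemma emeasure_lebesgue_Rd_1:
  assumes "S \<in> sets borel"
  shows "emeasure (lebesgue_Rd 1) {x \<in> space (lebesgue_Rd 1). x 0 \<in> S} = emeasure lborel S"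
proof -
  interpret product_sigma_finite "\<lambda>_::nat. lborel :: real measure"
    by (simp add: product_sigma_finite_def lborel.sigma_finite_measure_axioms)
  have L: "lebesgue_Rd 1 = PiM {0} (\<lambda>_. lborel)"
    by (simp add: lebesgue_Rd_def lessThan_Suc)
  have "emeasure lborel S = emeasure (distr (lebesgue_Rd 1) lborel (\<lambda>x. x 0)) S"
    unfolding L by (simp only: distr_singleton)
  also have "\<dots> = emeasure (lebesgue_Rd 1) ((\<lambda>x. x 0) -` S \<inter> space (lebesgue_Rd 1))"
    by (intro emeasure_distr) (use assms measurable_lebesgue_Rd_1 in simp_all)
  also have "(\<lambda>x. x 0) -` S \<inter> space (lebesgue_Rd 1) = {x \<in> space (lebesgue_Rd 1). x 0 \<in> S}"
    by auto
  finally show ?thesis ..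
qed

text \<open>Each slab is cut into N K intervals of equal length. The index of an interval, divided
  by K, gives the block as quotient and the cell as remainder.\<close>

lemma twin_grids_unit_slabs:
  assumes N: "0 < N" and K: "0 < K"
  shows "\<exists>b c. twin_grids (lebesgue_Rd 1) (unit_slab 0) (unit_slab 1) b c N K"
proof -
  define q where "q = N * K"
  have q: "0 < q"
    using N K by (simp add: q_def)
  \<comment> \<open>\<open>frac\<close> measures the position within a unit interval, so one
    labelling serves both slabs.\<close>
  define l where "l x = nat \<lfloor>real q * frac (x 0)\<rfloor>" for x :: "nat \<Rightarrow> real"
  have l_eq: "l x = i \<longleftrightarrow> x 0 \<in> {of_int e + real i / real q..<of_int e + real (Suc i) / real q}"
    if "x \<in> unit_slab e" for x e i
  proof -
    have "\<lfloor>x 0\<rfloor> = e"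
      using that by (intro floor_unique) (auto simp: unit_slab_def)
    then have frac: "frac (x 0) = x 0 - of_int e"
      by (simp add: frac_def)
    have nn: "0 \<le> \<lfloor>real q * frac (x 0)\<rfloor>"
      by simp
    have "l x = i \<longleftrightarrow> \<lfloor>real q * frac (x 0)\<rfloor> = int i"
      using nn unfolding l_def by linarith
    also have "\<dots> \<longleftrightarrow> real i \<le> real q * (x 0 - of_int e) \<and> real q * (x 0 - of_int e) < real (Suc i)"
      by (simp add: floor_eq_iff frac add.commute)
    also have "\<dots> \<longleftrightarrow> x 0 \<in> {of_int e + real i / real q..<of_int e + real (Suc i) / real q}"
      using q by (auto simp: field_simps)
    finally show ?thesis .
  qed
  have l_less: "l x < N * K" for x
  proof -
    have "real q * frac (x 0) < real q * 1"
      using q frac_lt_1[of "x 0"] by (intro mult_strict_left_mono) auto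
    then show ?thesis
      using q by (simp add: l_def q_def floor_less_iff nat_less_iff)
  qed
  have l_meas: "l \<in> measurable (lebesgue_Rd 1) (count_space UNIV)"
    unfolding l_def frac_def by measurable
  have cell: "emeasure (lebesgue_Rd 1) {x \<in> unit_slab e. l x div K = j \<and> l x mod K = k}
      = ennreal (1 / (real N * real K))" if j: "j < N" and k: "k < K" for e j k
  proof -
    define i where "i = j * K + k"
    \<comment> \<open>The interval with index \<open>i\<close> ends within the slab, which yields
      the inclusion of \<open>?R\<close> in \<open>?L\<close> below.\<close>
    have "Suc i \<le> Suc j * K"
      using k by (simp add: i_def)
    also have "\<dots> \<le> q"
      using j unfolding q_def by (intro mult_right_mono) auto
    finally have i: "Suc i \<le> q" .
    have iq: "0 \<le> real i / real q" "real (Suc i) / real q \<le> 1"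
      using i q by (auto simp: field_simps simp flip: of_nat_Suc)
    have dm: "l x div K = j \<and> l x mod K = k \<longleftrightarrow> l x = i" for x
      using k div_mult_mod_eq[of "l x" K] by (auto simp: i_def)
    have "{x \<in> unit_slab e. l x div K = j \<and> l x mod K = k}
        = {x \<in> space (lebesgue_Rd 1). x 0 \<in> {of_int e + real i / real q..<of_int e + real (Suc i) / real q}}"
      (is "?L = ?R")
    proof
      show "?L \<subseteq> ?R"
        using l_eq[of _ e] by (auto simp: dm unit_slab_def)
      show "?R \<subseteq> ?L"
      proof
        fix x assume x: "x \<in> ?R"
        then have "of_int e + real i / real q \<le> x 0" "x 0 < of_int e + real (Suc i) / real q"
          by (simp_all only: mem_Collect_eq atLeastLessThan_iff)
        then have "of_int e \<le> x 0" "x 0 < of_int e + 1"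
          using iq by linarith+
        then have "x \<in> unit_slab e"
          using x by (simp add: unit_slab_def)
        then show "x \<in> ?L"
          using x l_eq[of x e i] by (auto simp: dm)
      qed
    qed
    also have "emeasure (lebesgue_Rd 1) \<dots>
        = ennreal (of_int e + real (Suc i) / real q - (of_int e + real i / real q))"
      by (subst emeasure_lebesgue_Rd_1) (auto simp: divide_right_mono)
    also have "of_int e + real (Suc i) / real q - (of_int e + real i / real q) = 1 / (real N * real K)"
      by (simp add: q_def flip: diff_divide_distrib)
    finally show ?thesis .
  qed
  have "twin_grids (lebesgue_Rd 1) (unit_slab 0) (unit_slab 1) (\<lambda>x. l x div K) (\<lambda>x. l x mod K) N K"
  proof
    show "unit_slab 0 \<in> sets (lebesgue_Rd 1)" "unit_slab 1 \<in> sets (lebesgue_Rd 1)"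
      unfolding unit_slab_def by measurable
    show "unit_slab 0 \<inter> unit_slab 1 = {}"
      by (auto simp: unit_slab_def)
    show "(\<lambda>x. l x div K) \<in> measurable (lebesgue_Rd 1) (count_space UNIV)"
      "(\<lambda>x. l x mod K) \<in> measurable (lebesgue_Rd 1) (count_space UNIV)"
      by (rule measurable_compose[OF l_meas], simp)+
    show "l x div K < N" for x
      using l_less[of x] by (simp add: less_mult_imp_div_less)
    show "l x mod K < K" for x
      using K by simp
  qed (fact sigma_finite_measure.sigma_finite_countable[OF sigma_finite_lebesgue_Rd] cell N K)+
  then show ?thesis
    by blast
qed

lemma unit_slabs_not_robustly_testable:
  assumes "\<gamma> < sqrt 2 / (sqrt 2 - 1)"
  shows "model_class (lebesgue_Rd 1) (indicator (unit_slab 0)) (indicator (unit_slab 1))"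
    and "supp (lebesgue_Rd 1) (indicator (unit_slab 0)) \<inter> supp (lebesgue_Rd 1) (indicator (unit_slab 1)) = {}"
    and "\<not> robustly_testable (lebesgue_Rd 1) \<gamma> (indicator (unit_slab 0)) (indicator (unit_slab 1))"
proof -
  let ?M = "lebesgue_Rd 1"
  \<comment> \<open>A grid with a single cell gives access to the locale facts on mass and
    disjointness; K is chosen at the end.\<close>
  obtain b c where "twin_grids ?M (unit_slab 0) (unit_slab 1) b c 1 1"
    using twin_grids_unit_slabs[of 1 1] by auto
  then interpret twin_grids ?M "unit_slab 0" "unit_slab 1" b c 1 1 .
  show "supp ?M (indicator (unit_slab 0)) \<inter> supp ?M (indicator (unit_slab 1)) = {}"
    using disjoint by (auto simp: supp_def indicator_def)
  have "\<not> (AE x in ?M. indicator (unit_slab 0) x = (indicator (unit_slab 1) x :: real))"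
  proof
    assume "AE x in ?M. indicator (unit_slab 0) x = (indicator (unit_slab 1) x :: real)"
    then have "AE x in ?M. x \<notin> unit_slab 0"
      by eventually_elim (use disjoint in \<open>auto simp: indicator_def split: if_splits\<close>)
    then have "emeasure ?M (unit_slab 0) = 0"
      by (intro null_setsD1) (simp only: AE_iff_null_sets[OF sets_A])
    then show False
      using emeasure_A by simp
  qed
  then show "model_class ?M (indicator (unit_slab 0)) (indicator (unit_slab 1))"
    using indicator_distribution twin_grids.indicator_distribution[OF swap]
    by (simp add: model_class_def del: One_nat_def)
  \<comment> \<open>The quantity \<gamma> (1 - 1 / sqrt 2) is \<gamma> times the distance to the
    near model, and 1 is the limit of the distance to the far one. The strict inequality leaves room
    for a finite K.\<close>
  have "\<gamma> * (sqrt 2 - 1) < sqrt 2"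
    using assms by (simp add: field_simps)
  then have "\<gamma> * (1 - 1 / sqrt 2) < 1"
    by (simp add: field_simps)
  moreover have "(\<lambda>K. 1 - 1 / sqrt (2 * real K)) \<longlonglongrightarrow> 1"
    by real_asymp
  ultimately have "eventually (\<lambda>K. \<gamma> * (1 - 1 / sqrt 2) < 1 - 1 / sqrt (2 * real K)) sequentially"
    by (intro order_tendstoD)
  with eventually_gt_at_top[of 0]
  have "eventually (\<lambda>K. 0 < K \<and> \<gamma> * (1 - 1 / sqrt 2) < 1 - 1 / sqrt (2 * real K)) sequentially"
    by eventually_elim simp
  then obtain K where "0 < K" "\<gamma> * (1 - 1 / sqrt 2) \<le> 1 - 1 / sqrt (2 * real K)"
    by (auto simp: eventually_sequentially dest: less_imp_le)
  then show "\<not> robustly_testable ?M \<gamma> (indicator (unit_slab 0)) (indicator (unit_slab 1))"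
    by (intro not_robustly_testable_twin_grids[where K = K] twin_grids_unit_slabs)
qed

theorem mainTheorem2:
  shows "(\<forall>\<gamma>::real. \<gamma> > sqrt 2 / (sqrt 2 - 1) \<longrightarrow>
            (\<forall>(A :: 'a set) p0 p1. countable A \<longrightarrow> model_class (count_space A) p0 p1 \<longrightarrow>
               supp (count_space A) p0 \<inter> supp (count_space A) p1 = {} \<longrightarrow>
               robustly_testable (count_space A) \<gamma> p0 p1) \<and>
            (\<forall>d\<ge>1. \<forall>p0 p1. model_class (lebesgue_Rd d) p0 p1 \<longrightarrow>
               supp (lebesgue_Rd d) p0 \<inter> supp (lebesgue_Rd d) p1 = {} \<longrightarrow>
               robustly_testable (lebesgue_Rd d) \<gamma> p0 p1)) \<and>
         (\<forall>\<gamma>::real. 1 < \<gamma> \<and> \<gamma> < sqrt 2 / (sqrt 2 - 1) \<longrightarrow>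
            (\<exists>(A :: nat set) p0 p1. countable A \<and> model_class (count_space A) p0 p1 \<and>
               supp (count_space A) p0 \<inter> supp (count_space A) p1 = {} \<and>
               \<not> robustly_testable (count_space A) \<gamma> p0 p1) \<or>
            (\<exists>d\<ge>1. \<exists>p0 p1. model_class (lebesgue_Rd d) p0 p1 \<and>
               supp (lebesgue_Rd d) p0 \<inter> supp (lebesgue_Rd d) p1 = {} \<and>
               \<not> robustly_testable (lebesgue_Rd d) \<gamma> p0 p1))"
\<comment> \<open>The lower bound takes the Lebesgue alternative, with d = 1.\<close>
proof (intro conjI allI impI disjI2)
  fix \<gamma> :: real
  assume "1 < \<gamma> \<and> \<gamma> < sqrt 2 / (sqrt 2 - 1)"
  then show "\<exists>d\<ge>1. \<exists>p0 p1. model_class (lebesgue_Rd d) p0 p1 \<and>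
               supp (lebesgue_Rd d) p0 \<inter> supp (lebesgue_Rd d) p1 = {} \<and>
               \<not> robustly_testable (lebesgue_Rd d) \<gamma> p0 p1"
    using unit_slabs_not_robustly_testable by (meson order_refl)
qed (rule robustly_testable_disjoint_supp; simp add: model_class_def)+

end
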